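(* Let $V_1,V_2,V_3,V_4$, $p_1,p_2,p_3,p_4$ be the data of a string segment in $AdS_3$ satisfying the causality conditions (see context), let $A_\diamond$ be its world sheet area, and let $(a_i,\bar a_i)$, $i=1,2,3,4$, be the light cone coordinates of its boundary points. Consider the four points of $\mathbb{R}^{1,1}$ with light cone coordinates $$(b_1,\bar b_1)=(a_1,\bar a_2),\quad (b_3,\bar b_3)=(a_3,\bar a_4),\quad (b_4,\bar b_4)=(a_4,\bar a_3),\quad (b_2,\bar b_2)=(a_2,\bar a_1),$$ and the spacelike intervals $A$ with end points $b_1,b_3$; $B$ with end points $b_3,b_4$; $C$ with end points $b_4,b_2$. Let $AB$, $BC$, $ABC$ denote the intervals with end points $(b_1,b_4)$, $(b_3,b_2)$, $(b_1,b_2)$ respectively, and define the conditional mutual information $I(A,C\vert B)=S(AB)+S(BC)-S(ABC)-S(B)$. Then $$I(A,C\vert B)=\frac{A_\diamond}{4GL}.$$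
   Context: $\mathbb{R}^{2,2}$ has coordinates $X^{-1},X^0,X^1,X^2$ and bilinear form $X\cdot Y=-X^{-1}Y^{-1}-X^0Y^0+X^1Y^1+X^2Y^2$; $X^\pm=X^1\pm X^{-1}$. $AdS_3=\{X: X\cdot X=-L^2\}$ with $L>0$. A string segment is given by $V_1\in AdS_3$ and null vectors $p_1,p_4\in\mathbb{R}^{2,2}$ with $p_1\cdot V_1=p_4\cdot V_1=0$. Its world sheet is the image of $$X(\sigma^-,\sigma^+)=\frac{L^2+\sigma^-\sigma^+\frac12 p_1\cdot p_4}{L^2-\sigma^-\sigma^+\frac12 p_1\cdot p_4}V_1+L^2\frac{\sigma^-p_1+\sigma^+p_4}{L^2-\sigma^-\sigma^+\frac12 p_1\cdot p_4},\qquad \sigma^\pm\in[0,1],$$ with vertices $V_2=X(1,0)=V_1+p_1$, $V_4=X(0,1)=V_1+p_4$, $V_3=X(1,1)$, and $p_2=V_3-V_2$, $p_3=V_3-V_4$ (so $p_1+p_2=p_3+p_4$). $A_\diamond=\int_0^1\int_0^1\sqrt{-\det(\partial_\alpha X\cdot\partial_\beta X)}\,d\sigma^-d\sigma^+$ is its Lorentzian area. Boundary points (assuming $p_i^-\neq0$): $x_i=(t_i,x_i^1)=\frac{L}{p_i^-}(p_i^0,p_i^2)\in\mathbb{R}^{1,1}$, where $\mathbb{R}^{1,1}$ has product $x\bullet y=-x^0y^0+x^1y^1$. Light cone coordinates of a point $(t,x)$ are $a=t+x$, $\bar a=t-x$; so $a_i=t_i+x_i^1$, $\bar a_i=t_i-x_i^1$.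 Causality conditions: $V_i^->0$ for all $i$; $p_1\cdot p_4<0$; $(x_i-x_j)\bullet(x_i-x_j)<0$ for the neighbouring edges $(ij)=(12),(23),(34),(14)$; and $t_1<t_3<t_4<t_2$. Entropy: $G>0$ is the three-dimensional Newton constant, $c=\frac{3L}{2G}$, $\delta>0$ is a UV cutoff. For a spacelike interval $\mathcal{R}$ with end points having light cone coordinates $(y,\bar y)$ and $(z,\bar z)$, the (holographic) vacuum entanglement entropy is $S(\mathcal{R})=\frac{c}{6}\log\frac{|y-z|\,|\bar y-\bar z|}{\delta^2}$. *)

theory Defs
  imports "HOL-Analysis.Analysis"
begin

text \<open>
  Vectors of \<open>\<real>\<^sup>2\<^sup>,\<^sup>2\<close> are elements of \<^typ>\<open>real^4\<close>.  The index type \<^typ>\<open>4\<close> is arithmetic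
  modulo \<open>4\<close>, so \<open>-1, 0, 1, 2\<close> are its four distinct elements (\<open>-1 = 3\<close>) and the
  components \<open>X\<^sup>-\<^sup>1, X\<^sup>0, X\<^sup>1, X\<^sup>2\<close> can be written literally.
\<close>

type_synonym vec22 = "real^4"

definition ip22 :: "vec22 \<Rightarrow> vec22 \<Rightarrow> real" where
  "ip22 X Y = - (X $ (-1) * Y $ (-1)) - X $ 0 * Y $ 0 + X $ 1 * Y $ 1 + X $ 2 * Y $ 2"

definition minus_comp :: "vec22 \<Rightarrow> real" where
  "minus_comp X = X $ 1 - X $ (-1)"

definition AdS3 :: "real \<Rightarrow> vec22 set" where
  "AdS3 L = {X. ip22 X X = - L\<^sup>2}"

definition null_vector :: "vec22 \<Rightarrow> bool" where
  "null_vector p \<longleftrightarrow> ip22 p p = 0"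

definition string_segment :: "real \<Rightarrow> vec22 \<Rightarrow> vec22 \<Rightarrow> vec22 \<Rightarrow> bool" where
  "string_segment L V1 p1 p4 \<longleftrightarrow>
     V1 \<in> AdS3 L \<and> null_vector p1 \<and> null_vector p4 \<and> ip22 p1 V1 = 0 \<and> ip22 p4 V1 = 0"

text \<open>The last two arguments are \<open>\<sigma>\<^sup>-\<close> and \<open>\<sigma>\<^sup>+\<close>, in this order.\<close>

definition worldsheet :: "real \<Rightarrow> vec22 \<Rightarrow> vec22 \<Rightarrow> vec22 \<Rightarrow> real \<Rightarrow> real \<Rightarrow> vec22" where
  "worldsheet L V1 p1 p4 s t =
     ((L\<^sup>2 + s * t * (1/2) * ip22 p1 p4) / (L\<^sup>2 - s * t * (1/2) * ip22 p1 p4)) *\<^sub>R V1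
     + (L\<^sup>2 / (L\<^sup>2 - s * t * (1/2) * ip22 p1 p4)) *\<^sub>R (s *\<^sub>R p1 + t *\<^sub>R p4)"

text \<open>World sheet index \<open>1\<close> stands for \<open>\<sigma>\<^sup>-\<close>, index \<open>2\<close> for \<open>\<sigma>\<^sup>+\<close>.\<close>

definition partial_deriv :: "(real \<Rightarrow> real \<Rightarrow> vec22) \<Rightarrow> 2 \<Rightarrow> real \<Rightarrow> real \<Rightarrow> vec22" where
  "partial_deriv X \<alpha> s t =
     (if \<alpha> = 1 then vector_derivative (\<lambda>u. X u t) (at s)
      else vector_derivative (\<lambda>u. X s u) (at t))"

definition induced_metric :: "(real \<Rightarrow> real \<Rightarrow> vec22) \<Rightarrow> real \<Rightarrow> real \<Rightarrow> real^2^2" where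
  "induced_metric X s t = (\<chi> \<alpha> \<beta>. ip22 (partial_deriv X \<alpha> s t) (partial_deriv X \<beta> s t))"

definition lorentzian_area :: "(real \<Rightarrow> real \<Rightarrow> vec22) \<Rightarrow> real" where
  "lorentzian_area X =
     integral {0..1} (\<lambda>t. integral {0..1} (\<lambda>s. sqrt (- det (induced_metric X s t))))"

text \<open>Points of \<open>\<real>\<^sup>1\<^sup>,\<^sup>1\<close> are pairs \<open>(t, x)\<close>.\<close>

type_synonym vec11 = "real \<times> real"

definition ip11 :: "vec11 \<Rightarrow> vec11 \<Rightarrow> real" where
  "ip11 x y = - (fst x * fst y) + snd x * snd y"

definition timelike_separated :: "vec11 \<Rightarrow> vec11 \<Rightarrow> bool" where
  "timelike_separated x y \<longleftrightarrow> ip11 (x - y) (x - y) < 0"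

definition spacelike_separated :: "vec11 \<Rightarrow> vec11 \<Rightarrow> bool" where
  "spacelike_separated x y \<longleftrightarrow> ip11 (x - y) (x - y) > 0"

definition lc :: "vec11 \<Rightarrow> real" where
  "lc x = fst x + snd x"

definition lc_bar :: "vec11 \<Rightarrow> real" where
  "lc_bar x = fst x - snd x"

definition boundary_point :: "real \<Rightarrow> vec22 \<Rightarrow> vec11" where
  "boundary_point L p = (L / minus_comp p * p $ 0, L / minus_comp p * p $ 2)"

definition central_charge :: "real \<Rightarrow> real \<Rightarrow> real" where
  "central_charge L G = 3 * L / (2 * G)"

text \<open>
  An interval enters only through its end points; the formula is meaningful for
  spacelike separated end points.
\<close>

definition entropy :: "real \<Rightarrow> real \<Rightarrow> vec11 \<Rightarrow> vec11 \<Rightarrow> real" where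
  "entropy c \<delta> y z =
     c / 6 * ln (\<bar>lc y - lc z\<bar> * \<bar>lc_bar y - lc_bar z\<bar> / \<delta>\<^sup>2)"

text \<open>
  \<open>I(A,C|B)\<close> for the adjacent intervals \<open>A\<close> from \<open>u\<close> to \<open>v\<close>, \<open>B\<close> from \<open>v\<close> to \<open>w\<close> and
  \<open>C\<close> from \<open>w\<close> to \<open>z\<close>.
\<close>

definition cond_mutual_information ::
    "real \<Rightarrow> real \<Rightarrow> vec11 \<Rightarrow> vec11 \<Rightarrow> vec11 \<Rightarrow> vec11 \<Rightarrow> real" where
  "cond_mutual_information c \<delta> u v w z =
     entropy c \<delta> u w + entropy c \<delta> v z - entropy c \<delta> u z - entropy c \<delta> v w"

end

theory Submission
  imports Defs
begin

text \<open>
  Put \<open>k = - p1 \<cdot> p4 / 2 > 0\<close>.  In the given parametrisation the induced metric is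
  \<open>- 4 k L\<^sup>4 / (L\<^sup>2 + k \<sigma>\<^sup>- \<sigma>\<^sup>+)\<^sup>2 d\<sigma>\<^sup>- d\<sigma>\<^sup>+\<close>, so the area is
  \<open>2 L\<^sup>2 ln ((L\<^sup>2 + k) / L\<^sup>2)\<close>.  On the boundary side, \<open>p\<^sub>i \<cdot> p\<^sub>j\<close> is
  \<open>p\<^sub>i\<^sup>- p\<^sub>j\<^sup>- (a\<^sub>i - a\<^sub>j) (\<bar>a\<^sub>i - \<bar>a\<^sub>j) / (2 L\<^sup>2)\<close>, so the cross ratio in the conditional
  mutual information equals \<open>(p1 \<cdot> p4) (p2 \<cdot> p3) / ((p1 \<cdot> p2) (p3 \<cdot> p4)) = ((L\<^sup>2 + k) / L\<^sup>2)\<^sup>2\<close>.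
  Neighbouring \<open>p\<^sub>i\<^sup>-\<close> have opposite signs and \<open>p1 \<cdot> p3, p2 \<cdot> p4 > 0\<close>, so the diagonal pairs
  \<open>x1, x3\<close> and \<open>x4, x2\<close> are timelike separated as well; hence \<open>x1, x3, x4, x2\<close> are causally
  ordered, which makes all the intervals spacelike.
\<close>

section \<open>Bilinearity of the ambient form\<close>

lemma ip22_commute: "ip22 X Y = ip22 Y X"
  by (simp add: ip22_def)

lemma ip22_add_left: "ip22 (X + Y) Z = ip22 X Z + ip22 Y Z"
  by (simp add: ip22_def algebra_simps)

lemma ip22_diff_left: "ip22 (X - Y) Z = ip22 X Z - ip22 Y Z"
  by (simp add: ip22_def algebra_simps)

lemma ip22_scaleR_left: "ip22 (c *\<^sub>R X) Z = c * ip22 X Z"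
  by (simp add: ip22_def algebra_simps)

lemma ip22_add_right: "ip22 Z (X + Y) = ip22 Z X + ip22 Z Y"
  by (simp add: ip22_def algebra_simps)

lemma ip22_diff_right: "ip22 Z (X - Y) = ip22 Z X - ip22 Z Y"
  by (simp add: ip22_def algebra_simps)

lemma ip22_scaleR_right: "ip22 Z (c *\<^sub>R X) = c * ip22 Z X"
  by (simp add: ip22_def algebra_simps)

lemmas ip22_linear = ip22_add_left ip22_diff_left ip22_scaleR_left
  ip22_add_right ip22_diff_right ip22_scaleR_right

section \<open>The world sheet metric and its area\<close>

text \<open>Thanks to this symmetry only the \<open>\<sigma>\<^sup>-\<close> derivative has to be
  computed; the other one follows by exchanging the edges.\<close>

lemma worldsheet_commute: "worldsheet L V p q s t = worldsheet L V q p t s"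
  by (simp add: worldsheet_def ip22_commute[of q p] mult.commute[of s t] add.commute)

text \<open>The coefficients of \<open>V\<close>, \<open>p\<close> and \<open>q\<close> share the
  derivative factor \<open>L\<^sup>2 / (L\<^sup>2 + s * t * k)\<^sup>2\<close>. What remains is
  independent of \<open>s\<close>: the parameter lines are straight.\<close>

lemma worldsheet_has_vector_derivative:
  assumes k: "ip22 p q = - 2 * k" and D: "L\<^sup>2 + s * t * k \<noteq> 0"
  shows "((\<lambda>u. worldsheet L V p q u t) has_vector_derivative
     (L\<^sup>2 / (L\<^sup>2 + s * t * k)\<^sup>2) *\<^sub>R (L\<^sup>2 *\<^sub>R p - (2 * t * k) *\<^sub>R V - (t\<^sup>2 * k) *\<^sub>R q)) (at s)"
proof -
  let ?D = "L\<^sup>2 + s * t * k"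
  have eq: "worldsheet L V p q u t = ((L\<^sup>2 - u * t * k) / (L\<^sup>2 + u * t * k)) *\<^sub>R V
      + (L\<^sup>2 * u / (L\<^sup>2 + u * t * k)) *\<^sub>R p + (L\<^sup>2 * t / (L\<^sup>2 + u * t * k)) *\<^sub>R q" for u
    by (simp add: worldsheet_def k scaleR_add_right ac_simps)
  have 1: "((\<lambda>u. (L\<^sup>2 - u * t * k) / (L\<^sup>2 + u * t * k)) has_real_derivative
      (L\<^sup>2 / ?D\<^sup>2) * (- 2 * t * k)) (at s)"
    using D by (auto intro!: derivative_eq_intros simp: field_simps power2_eq_square)
  have 2: "((\<lambda>u. L\<^sup>2 * u / (L\<^sup>2 + u * t * k)) has_real_derivative (L\<^sup>2 / ?D\<^sup>2) * L\<^sup>2) (at s)"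
    using D by (auto intro!: derivative_eq_intros simp: field_simps power2_eq_square)
  have 3: "((\<lambda>u. L\<^sup>2 * t / (L\<^sup>2 + u * t * k)) has_real_derivative
      (L\<^sup>2 / ?D\<^sup>2) * (- (t\<^sup>2 * k))) (at s)"
    using D by (auto intro!: derivative_eq_intros simp: field_simps power2_eq_square)
  show ?thesis
    unfolding eq
    by (rule has_vector_derivative_eq_rhs,
        rule has_vector_derivative_add[OF has_vector_derivative_add],
        rule has_vector_derivative_scaleR[OF 1 has_vector_derivative_const],
        rule has_vector_derivative_scaleR[OF 2 has_vector_derivative_const],
        rule has_vector_derivative_scaleR[OF 3 has_vector_derivative_const])
      (simp add: scaleR_diff_right scaleR_add_right algebra_simps)
qed

text \<open>Both tangent directions are null, so the determinant is minus the square of the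
  off-diagonal entry. The product of \<open>?P\<close> and \<open>?Q\<close> is
  \<open>- 2 * k\<close> times a perfect square, which cancels two of the four powers of
  \<open>?D\<close>.\<close>

lemma area_density:
  assumes seg: "string_segment L V p q" and k: "ip22 p q = - 2 * k"
    and "k > 0" and D: "L\<^sup>2 + s * t * k > 0"
  shows "sqrt (- det (induced_metric (worldsheet L V p q) s t))
    = 2 * k * L ^ 4 / (L\<^sup>2 + s * t * k)\<^sup>2"
proof -
  let ?D = "L\<^sup>2 + s * t * k"
  let ?P = "L\<^sup>2 *\<^sub>R p - (2 * t * k) *\<^sub>R V - (t\<^sup>2 * k) *\<^sub>R q"
  let ?Q = "L\<^sup>2 *\<^sub>R q - (2 * s * k) *\<^sub>R V - (s\<^sup>2 * k) *\<^sub>R p"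
  have V: "ip22 V V = - L\<^sup>2" and pp: "ip22 p p = 0" "ip22 q q = 0"
    and pV: "ip22 p V = 0" "ip22 V p = 0" "ip22 q V = 0" "ip22 V q = 0"
    and qp: "ip22 q p = - 2 * k"
    using seg k by (simp_all add: string_segment_def AdS3_def null_vector_def ip22_commute)
  have ds: "vector_derivative (\<lambda>u. worldsheet L V p q u t) (at s) = (L\<^sup>2 / ?D\<^sup>2) *\<^sub>R ?P"
    using worldsheet_has_vector_derivative[OF k] D by (intro vector_derivative_at) simp
  have dt: "vector_derivative (\<lambda>u. worldsheet L V p q s u) (at t) = (L\<^sup>2 / ?D\<^sup>2) *\<^sub>R ?Q"
    using worldsheet_has_vector_derivative[OF qp, of L t s V] D
    by (intro vector_derivative_at) (simp add: worldsheet_commute[of L V p q s] mult.commute)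
  have pd: "partial_deriv (worldsheet L V p q) 1 s t = (L\<^sup>2 / ?D\<^sup>2) *\<^sub>R ?P"
      "partial_deriv (worldsheet L V p q) 2 s t = (L\<^sup>2 / ?D\<^sup>2) *\<^sub>R ?Q"
    by (simp_all add: partial_deriv_def ds dt)
  have PP: "ip22 ?P ?P = 0" and QQ: "ip22 ?Q ?Q = 0"
    by (simp_all add: ip22_linear V pp pV k qp algebra_simps power2_eq_square)
  have PQ: "ip22 ?P ?Q = - 2 * k * ?D\<^sup>2"
    by (simp add: ip22_linear V pp pV k qp algebra_simps power2_eq_square)
  have g: "induced_metric (worldsheet L V p q) s t $ \<alpha> $ \<beta>
     = ip22 (partial_deriv (worldsheet L V p q) \<alpha> s t) (partial_deriv (worldsheet L V p q) \<beta> s t)"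
    for \<alpha> \<beta> by (simp add: induced_metric_def)
  have "det (induced_metric (worldsheet L V p q) s t)
      = - ((L\<^sup>2 / ?D\<^sup>2) * ((L\<^sup>2 / ?D\<^sup>2) * ip22 ?P ?Q))\<^sup>2"
    unfolding det_2 g
    by (simp only: pd ip22_scaleR_left ip22_scaleR_right PP QQ ip22_commute[of ?Q ?P]
        mult_zero_left mult_zero_right diff_0) (simp only: power2_eq_square)
  also have "(L\<^sup>2 / ?D\<^sup>2) * ((L\<^sup>2 / ?D\<^sup>2) * ip22 ?P ?Q) = - (2 * k * L ^ 4 / ?D\<^sup>2)"
    unfolding PQ using D by (simp add: divide_simps power2_eq_square) (simp add: algebra_simps power4_eq_xxxx)
  finally show ?thesis
    using \<open>k > 0\<close> by simp
qed

lemma lorentzian_area_worldsheet: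
  assumes seg: "string_segment L V p q" and k: "ip22 p q = - 2 * k"
    and "k > 0" and "L > 0"
  shows "lorentzian_area (worldsheet L V p q) = 2 * L\<^sup>2 * ln ((L\<^sup>2 + k) / L\<^sup>2)"
proof -
  have pos: "L\<^sup>2 + s * t * k > 0" if "s \<in> {0..1}" "t \<in> {0..1}" for s t
    using that \<open>k > 0\<close> \<open>L > 0\<close> by (intro add_pos_nonneg) auto
  have inner: "integral {0..1} (\<lambda>s. sqrt (- det (induced_metric (worldsheet L V p q) s t)))
      = 2 * k * L\<^sup>2 / (L\<^sup>2 + t * k)" if t: "t \<in> {0..1}" for t
  proof -
    \<comment> \<open>The primitive has \<open>s\<close> in its numerator, so it vanishes at
      \<open>s = 0\<close> and involves no division by \<open>t\<close>; \<open>t = 0\<close> needs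
      no separate case. The end point values are left unevaluated to match the fundamental
      theorem.\<close>
    have "((\<lambda>s. 2 * k * L ^ 4 / (L\<^sup>2 + s * t * k)\<^sup>2) has_integral
        2 * k * L\<^sup>2 * 1 / (L\<^sup>2 + 1 * t * k) - 2 * k * L\<^sup>2 * 0 / (L\<^sup>2 + 0 * t * k)) {0..1}"
    proof (rule fundamental_theorem_of_calculus)
      fix s :: real assume "s \<in> {0..1}"
      then have "L\<^sup>2 + s * t * k \<noteq> 0" using pos[of s t] t by simp
      then show "((\<lambda>s. 2 * k * L\<^sup>2 * s / (L\<^sup>2 + s * t * k)) has_vector_derivative
          2 * k * L ^ 4 / (L\<^sup>2 + s * t * k)\<^sup>2) (at s within {0..1})"
        unfolding has_real_derivative_iff_has_vector_derivative[symmetric]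
        by (auto intro!: derivative_eq_intros
            simp: field_simps power2_eq_square power4_eq_xxxx)
    qed simp
    then have "((\<lambda>s. sqrt (- det (induced_metric (worldsheet L V p q) s t)))
        has_integral 2 * k * L\<^sup>2 / (L\<^sup>2 + t * k)) {0..1}"
      by (subst has_integral_cong[OF area_density[OF seg k \<open>k > 0\<close> pos[OF _ t]]]) simp_all
    then show ?thesis by (rule integral_unique)
  qed
  have "((\<lambda>t. 2 * k * L\<^sup>2 / (L\<^sup>2 + t * k)) has_integral
      2 * L\<^sup>2 * ln (L\<^sup>2 + 1 * k) - 2 * L\<^sup>2 * ln (L\<^sup>2 + 0 * k)) {0..1}"
  proof (rule fundamental_theorem_of_calculus)
    fix t :: real assume "t \<in> {0..1}"
    then have "L\<^sup>2 + t * k > 0" using pos[of 1 t] by simp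
    then show "((\<lambda>t. 2 * L\<^sup>2 * ln (L\<^sup>2 + t * k)) has_vector_derivative
        2 * k * L\<^sup>2 / (L\<^sup>2 + t * k)) (at t within {0..1})"
      unfolding has_real_derivative_iff_has_vector_derivative[symmetric]
      by (auto intro!: derivative_eq_intros simp: field_simps)
  qed simp
  then have "integral {0..1} (\<lambda>t. 2 * k * L\<^sup>2 / (L\<^sup>2 + t * k))
      = 2 * L\<^sup>2 * ln (L\<^sup>2 + k) - 2 * L\<^sup>2 * ln (L\<^sup>2)"
    by (intro integral_unique) simp
  also have "\<dots> = 2 * L\<^sup>2 * ln ((L\<^sup>2 + k) / L\<^sup>2)"
    using pos[of 1 1] \<open>L > 0\<close> by (subst ln_div) (auto simp: right_diff_distrib)
  finally show ?thesis
    unfolding lorentzian_area_def by (simp only: integral_cong[OF inner])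
qed

section \<open>Products of the four edges\<close>

text \<open>All edges are combinations of \<open>V1\<close>, \<open>p1\<close>, \<open>p4\<close>,
  whose mutual products are known. The cross ratio and the causal order of the boundary points are
  read off from these values.\<close>

lemma string_segment_ip22:
  assumes seg: "string_segment L V1 p1 p4" and k: "ip22 p1 p4 = - 2 * k"
    and "k > 0" and "L > 0"
    and p2: "p2 = worldsheet L V1 p1 p4 1 1 - worldsheet L V1 p1 p4 1 0"
    and p3: "p3 = worldsheet L V1 p1 p4 1 1 - worldsheet L V1 p1 p4 0 1"
  shows "ip22 p2 p2 = 0" and "ip22 p3 p3 = 0"
    and "ip22 p1 p2 = - 2 * k * L\<^sup>2 / (L\<^sup>2 + k)" and "ip22 p3 p4 = - 2 * k * L\<^sup>2 / (L\<^sup>2 + k)"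
    and "ip22 p2 p3 = - 2 * k"
    and "ip22 p1 p3 = 2 * k\<^sup>2 / (L\<^sup>2 + k)" and "ip22 p2 p4 = 2 * k\<^sup>2 / (L\<^sup>2 + k)"
proof -
  have V: "ip22 V1 V1 = - L\<^sup>2" and pp: "ip22 p1 p1 = 0" "ip22 p4 p4 = 0"
    and pV: "ip22 p1 V1 = 0" "ip22 V1 p1 = 0" "ip22 p4 V1 = 0" "ip22 V1 p4 = 0"
    and qp: "ip22 p4 p1 = - 2 * k"
    using seg k by (simp_all add: string_segment_def AdS3_def null_vector_def ip22_commute)
  have D: "L\<^sup>2 + k > 0" using \<open>k > 0\<close> by (simp add: add_nonneg_pos)
  have c: "(L\<^sup>2 - k) / (L\<^sup>2 + k) - 1 = - 2 * k / (L\<^sup>2 + k)"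
      "L\<^sup>2 / (L\<^sup>2 + k) - 1 = - k / (L\<^sup>2 + k)"
    using D by (simp_all add: field_simps)
  let ?r = "1 / (L\<^sup>2 + k)"
  have V3: "worldsheet L V1 p1 p4 1 1
      = ((L\<^sup>2 - k) / (L\<^sup>2 + k)) *\<^sub>R V1 + (L\<^sup>2 / (L\<^sup>2 + k)) *\<^sub>R (p1 + p4)"
    by (simp add: worldsheet_def k)
  have V24: "worldsheet L V1 p1 p4 1 0 = V1 + p1" "worldsheet L V1 p1 p4 0 1 = V1 + p4"
    using \<open>L > 0\<close> by (simp_all add: worldsheet_def)
  \<comment> \<open>Up to the factor \<open>?r\<close> this is the tangent \<open>?Q\<close> of
    \<open>area_density\<close> at \<open>s = 1\<close>, along the side where \<open>p2\<close>
    lies; likewise \<open>p3\<close> is \<open>?P\<close> at \<open>t = 1\<close>.\<close>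
  have p2': "p2 = ?r *\<^sub>R (L\<^sup>2 *\<^sub>R p4 - (2 * k) *\<^sub>R V1 - k *\<^sub>R p1)"
  proof -
    have "p2 = ((L\<^sup>2 - k) / (L\<^sup>2 + k) - 1) *\<^sub>R V1 + (L\<^sup>2 / (L\<^sup>2 + k) - 1) *\<^sub>R p1
        + (L\<^sup>2 / (L\<^sup>2 + k)) *\<^sub>R p4"
      unfolding p2 V3 V24 by (simp add: algebra_simps)
    then show ?thesis unfolding c by (simp add: algebra_simps)
  qed
  have p3': "p3 = ?r *\<^sub>R (L\<^sup>2 *\<^sub>R p1 - (2 * k) *\<^sub>R V1 - k *\<^sub>R p4)"
  proof -
    have "p3 = ((L\<^sup>2 - k) / (L\<^sup>2 + k) - 1) *\<^sub>R V1 + (L\<^sup>2 / (L\<^sup>2 + k) - 1) *\<^sub>R p4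
        + (L\<^sup>2 / (L\<^sup>2 + k)) *\<^sub>R p1"
      unfolding p3 V3 V24 by (simp add: algebra_simps)
    then show ?thesis unfolding c by (simp add: algebra_simps)
  qed
  show "ip22 p2 p2 = 0" "ip22 p3 p3 = 0" "ip22 p1 p2 = - 2 * k * L\<^sup>2 / (L\<^sup>2 + k)"
      "ip22 p3 p4 = - 2 * k * L\<^sup>2 / (L\<^sup>2 + k)"
      "ip22 p1 p3 = 2 * k\<^sup>2 / (L\<^sup>2 + k)" "ip22 p2 p4 = 2 * k\<^sup>2 / (L\<^sup>2 + k)"
    unfolding p2' p3'
    by (simp_all add: ip22_linear V pp pV k qp power2_eq_square)
  \<comment> \<open>Keeping both factors \<open>?r\<close> outside exposes the same perfect square
    as in \<open>area_density\<close>, now at \<open>s = t = 1\<close>.\<close>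
  have "ip22 p2 p3 = ?r * (?r * (- 2 * k * (L\<^sup>2 + k)\<^sup>2))"
    unfolding p2' p3' ip22_scaleR_left[of ?r] ip22_scaleR_right[of _ ?r]
    by (simp add: ip22_linear V pp pV k qp power2_eq_square algebra_simps)
  then show "ip22 p2 p3 = - 2 * k"
    using D by (simp add: power2_eq_square)
qed

section \<open>From null vectors to causal relations on the boundary\<close>

text \<open>A null vector with nonzero minus component is fixed by that component and its boundary
  point, because nullness determines the plus component. For timelike separated points the sign of
  the product is thus that of the two minus components.\<close>

lemma ip22_null_eq_boundary:
  assumes "ip22 p p = 0" "ip22 q q = 0" "minus_comp p \<noteq> 0" "minus_comp q \<noteq> 0" "L > 0"
    and x: "x = boundary_point L p" and y: "y = boundary_point L q"
  shows "ip22 p q = minus_comp p * minus_comp q / (2 * L\<^sup>2)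
    * ((lc x - lc y) * (lc_bar x - lc_bar y))"
proof -
  define M N where "M = minus_comp p" and "N = minus_comp q"
  have "M \<noteq> 0" "N \<noteq> 0" using assms by (simp_all add: M_def N_def)
  have p1: "p $ 1 = M + p $ (-1)" and q1: "q $ 1 = N + q $ (-1)"
    by (simp_all add: M_def N_def minus_comp_def)
  \<comment> \<open>\<open>M + 2 * p $ (-1)\<close> is the plus component of \<open>p\<close>, so
    this is nullness in light cone form.\<close>
  have P: "(p $ 0 + p $ 2) * (p $ 0 - p $ 2) = M * (M + 2 * p $ (-1))"
    and Q: "(q $ 0 + q $ 2) * (q $ 0 - q $ 2) = N * (N + 2 * q $ (-1))"
    using assms(1,2) by (simp_all add: ip22_def p1 q1 algebra_simps)
  have l: "lc x = L * (p $ 0 + p $ 2) / M" "lc_bar x = L * (p $ 0 - p $ 2) / M"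
    "lc y = L * (q $ 0 + q $ 2) / N" "lc_bar y = L * (q $ 0 - q $ 2) / N"
    by (simp_all add: x y boundary_point_def lc_def lc_bar_def M_def N_def
        add_divide_distrib diff_divide_distrib distrib_left right_diff_distrib)
  define A A' B B' where "A = p $ 0 + p $ 2" and "A' = p $ 0 - p $ 2"
    and "B = q $ 0 + q $ 2" and "B' = q $ 0 - q $ 2"
  have "M * N / (2 * L\<^sup>2) * ((lc x - lc y) * (lc_bar x - lc_bar y))
      = ((A * A') / M * N + (B * B') / N * M - A * B' - A' * B) / 2"
    unfolding l A_def[symmetric] A'_def[symmetric] B_def[symmetric] B'_def[symmetric]
    using \<open>M \<noteq> 0\<close> \<open>N \<noteq> 0\<close> \<open>L > 0\<close> by (simp add: field_simps power2_eq_square)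
  also have "\<dots> = ((M + 2 * p $ (-1)) * N + (N + 2 * q $ (-1)) * M - A * B' - A' * B) / 2"
    using P Q \<open>M \<noteq> 0\<close> \<open>N \<noteq> 0\<close> by (simp add: A_def A'_def B_def B'_def)
  also have "\<dots> = ip22 p q"
    by (simp add: ip22_def p1 q1 A_def A'_def B_def B'_def algebra_simps add_divide_distrib diff_divide_distrib)
  finally show ?thesis by (simp add: M_def N_def)
qed

lemma ip11_diff_lc: "ip11 (x - y) (x - y) = - ((lc x - lc y) * (lc_bar x - lc_bar y))"
  by (simp add: ip11_def lc_def lc_bar_def algebra_simps)

text \<open>The two differences have the same sign, and their sum is twice the negative time
  difference.\<close>

lemma timelike_future_lc:
  assumes "(lc x - lc y) * (lc_bar x - lc_bar y) > 0" and "fst x < fst y"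
  shows "lc x < lc y" and "lc_bar x < lc_bar y"
proof -
  have "(lc x - lc y) + (lc_bar x - lc_bar y) < 0"
    using assms(2) by (simp add: lc_def lc_bar_def)
  then show "lc x < lc y" "lc_bar x < lc_bar y"
    using assms(1) by (auto simp: zero_less_mult_iff)
qed

section \<open>Conditional mutual information as a cross ratio\<close>

text \<open>Two entropies enter with each sign, so the cutoff cancels. The inequalities keep every
  logarithm argument nonzero, as splitting the logarithms requires.\<close>

lemma cond_mutual_information_cross_ratio:
  assumes "lc u \<noteq> lc w" "lc_bar u \<noteq> lc_bar w" "lc v \<noteq> lc z" "lc_bar v \<noteq> lc_bar z"
    and "lc u \<noteq> lc z" "lc_bar u \<noteq> lc_bar z" "lc v \<noteq> lc w" "lc_bar v \<noteq> lc_bar w"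
    and "\<delta> > 0"
  shows "cond_mutual_information c \<delta> u v w z = c / 6 * ln
    \<bar>((lc u - lc w) * (lc_bar u - lc_bar w) * ((lc v - lc z) * (lc_bar v - lc_bar z)))
     / ((lc u - lc z) * (lc_bar u - lc_bar z) * ((lc v - lc w) * (lc_bar v - lc_bar w)))\<bar>"
proof -
  have ln_abs: "c / 6 * ln (\<bar>a\<bar> * \<bar>a'\<bar> / \<delta>\<^sup>2) + c / 6 * ln (\<bar>b\<bar> * \<bar>b'\<bar> / \<delta>\<^sup>2)
      - c / 6 * ln (\<bar>e\<bar> * \<bar>e'\<bar> / \<delta>\<^sup>2) - c / 6 * ln (\<bar>f\<bar> * \<bar>f'\<bar> / \<delta>\<^sup>2)
      = c / 6 * ln \<bar>(a * a' * (b * b')) / (e * e' * (f * f'))\<bar>"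
    if "a \<noteq> 0" "a' \<noteq> 0" "b \<noteq> 0" "b' \<noteq> 0" "e \<noteq> 0" "e' \<noteq> 0" "f \<noteq> 0" "f' \<noteq> 0"
    for a a' b b' e e' f f' :: real
    using that \<open>\<delta> > 0\<close>
    by (simp add: abs_mult abs_divide ln_mult ln_div algebra_simps)
  show ?thesis
    unfolding cond_mutual_information_def entropy_def
    by (rule ln_abs) (use assms in simp_all)
qed

theorem mainTheorem1:
  fixes L G \<delta> :: real
    and V1 V2 V3 V4 p1 p2 p3 p4 :: vec22
    and x1 x2 x3 x4 b1 b2 b3 b4 :: vec11
  assumes "L > 0" and "G > 0" and "\<delta> > 0"
    and "string_segment L V1 p1 p4"
    and "V2 = worldsheet L V1 p1 p4 1 0"
    and "V3 = worldsheet L V1 p1 p4 1 1"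
    and "V4 = worldsheet L V1 p1 p4 0 1"
    and "p2 = V3 - V2" and "p3 = V3 - V4"
    and "minus_comp p1 \<noteq> 0" and "minus_comp p2 \<noteq> 0"
    and "minus_comp p3 \<noteq> 0" and "minus_comp p4 \<noteq> 0"
    and "x1 = boundary_point L p1" and "x2 = boundary_point L p2"
    and "x3 = boundary_point L p3" and "x4 = boundary_point L p4"
    and "minus_comp V1 > 0" and "minus_comp V2 > 0"
    and "minus_comp V3 > 0" and "minus_comp V4 > 0"
    and "ip22 p1 p4 < 0"
    and "timelike_separated x1 x2" and "timelike_separated x2 x3"
    and "timelike_separated x3 x4" and "timelike_separated x1 x4"
    and "fst x1 < fst x3" and "fst x3 < fst x4" and "fst x4 < fst x2"
    and "lc b1 = lc x1" and "lc_bar b1 = lc_bar x2"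
    and "lc b3 = lc x3" and "lc_bar b3 = lc_bar x4"
    and "lc b4 = lc x4" and "lc_bar b4 = lc_bar x3"
    and "lc b2 = lc x2" and "lc_bar b2 = lc_bar x1"
  shows "spacelike_separated b1 b3 \<and> spacelike_separated b3 b4 \<and> spacelike_separated b4 b2
       \<and> spacelike_separated b1 b4 \<and> spacelike_separated b3 b2 \<and> spacelike_separated b1 b2
       \<and> cond_mutual_information (central_charge L G) \<delta> b1 b3 b4 b2
           = lorentzian_area (worldsheet L V1 p1 p4) / (4 * G * L)"
proof -
  define k where "k = - ip22 p1 p4 / 2"
  have k: "ip22 p1 p4 = - 2 * k" and "k > 0"
    using assms by (simp_all add: k_def)
  note seg = \<open>string_segment L V1 p1 p4\<close>
  have L: "L\<^sup>2 + k > 0" "L\<^sup>2 > 0" using \<open>k > 0\<close> \<open>L > 0\<close> by (simp_all add: add_pos_pos)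
  have p2: "p2 = worldsheet L V1 p1 p4 1 1 - worldsheet L V1 p1 p4 1 0"
    and p3: "p3 = worldsheet L V1 p1 p4 1 1 - worldsheet L V1 p1 p4 0 1"
    using assms by simp_all
  note ip = string_segment_ip22[OF seg k \<open>k > 0\<close> \<open>L > 0\<close> p2 p3]
  have null: "ip22 p1 p1 = 0" "ip22 p4 p4 = 0"
    using seg by (simp_all add: string_segment_def null_vector_def)
  define m1 m2 m3 m4 where "m1 = minus_comp p1" and "m2 = minus_comp p2"
    and "m3 = minus_comp p3" and "m4 = minus_comp p4"
  have m0: "m1 \<noteq> 0" "m2 \<noteq> 0" "m3 \<noteq> 0" "m4 \<noteq> 0"
    using assms by (simp_all add: m1_def m2_def m3_def m4_def)
  define d :: "vec11 \<Rightarrow> vec11 \<Rightarrow> real" where "d = (\<lambda>x y. (lc x - lc y) * (lc_bar x - lc_bar y))"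
  have e12: "ip22 p1 p2 = m1 * m2 / (2 * L\<^sup>2) * d x1 x2"
    and e23: "ip22 p2 p3 = m2 * m3 / (2 * L\<^sup>2) * d x2 x3"
    and e34: "ip22 p3 p4 = m3 * m4 / (2 * L\<^sup>2) * d x3 x4"
    and e14: "ip22 p1 p4 = m1 * m4 / (2 * L\<^sup>2) * d x1 x4"
    and e13: "ip22 p1 p3 = m1 * m3 / (2 * L\<^sup>2) * d x1 x3"
    and e24: "ip22 p2 p4 = m2 * m4 / (2 * L\<^sup>2) * d x2 x4"
    unfolding m1_def m2_def m3_def m4_def d_def
    by (rule ip22_null_eq_boundary; use assms null ip(1,2) in blast)+
  have d: "d x1 x2 > 0" "d x2 x3 > 0" "d x3 x4 > 0" "d x1 x4 > 0"
    using assms by (simp_all add: timelike_separated_def ip11_diff_lc d_def)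
  have neg: "m1 * m2 < 0" "m2 * m3 < 0" "m1 * m4 < 0"
  proof -
    have "m1 * m2 / (2 * L\<^sup>2) * d x1 x2 < 0"
      unfolding e12[symmetric] ip(3) using divide_pos_pos[OF mult_pos_pos[OF \<open>k > 0\<close> L(2)] L(1)] by simp
    then show "m1 * m2 < 0" using d L by (simp add: mult_less_0_iff divide_less_0_iff)
    have "m2 * m3 / (2 * L\<^sup>2) * d x2 x3 < 0"
      using e23 ip(5) \<open>k > 0\<close> by simp
    then show "m2 * m3 < 0" using d L by (simp add: mult_less_0_iff divide_less_0_iff)
    have "m1 * m4 / (2 * L\<^sup>2) * d x1 x4 < 0"
      using e14 k \<open>k > 0\<close> by simp
    then show "m1 * m4 < 0" using d L by (simp add: mult_less_0_iff divide_less_0_iff)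
  qed
  \<comment> \<open>Two sign changes compose: edges 1 and 3 are compared through edge 2, edges 2 and
    4 through edge 1.\<close>
  then have "m1 * m3 > 0" "m2 * m4 > 0"
    by (auto simp: mult_less_0_iff zero_less_mult_iff)
  moreover have "m1 * m3 / (2 * L\<^sup>2) * d x1 x3 > 0" "m2 * m4 / (2 * L\<^sup>2) * d x2 x4 > 0"
    unfolding e13[symmetric] e24[symmetric] ip(6,7) using \<open>k > 0\<close> L(1)
    by (simp_all add: divide_pos_pos)
  ultimately have d': "d x1 x3 > 0" "d x2 x4 > 0"
    using L by (auto simp: zero_less_mult_iff mult_less_0_iff zero_less_divide_iff)
  have sym: "d x y = d y x" for x y by (simp add: d_def algebra_simps)
  note t = \<open>fst x1 < fst x3\<close> \<open>fst x3 < fst x4\<close> \<open>fst x4 < fst x2\<close>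
  have future: "lc x < lc y \<and> lc_bar x < lc_bar y" if "d x y > 0" "fst x < fst y" for x y
    using timelike_future_lc[of x y] that by (simp add: d_def)
  \<comment> \<open>The outer two comparisons rest on the diagonal signs \<open>d'\<close>, the
    middle one on the neighbours \<open>x3\<close>, \<open>x4\<close>.\<close>
  have o: "lc x1 < lc x3 \<and> lc_bar x1 < lc_bar x3" "lc x3 < lc x4 \<and> lc_bar x3 < lc_bar x4"
      "lc x4 < lc x2 \<and> lc_bar x4 < lc_bar x2"
    using d d' t sym[of x2 x4] by (auto intro!: future)
  note b = \<open>lc b1 = lc x1\<close> \<open>lc_bar b1 = lc_bar x2\<close> \<open>lc b3 = lc x3\<close> \<open>lc_bar b3 = lc_bar x4\<close>
    \<open>lc b4 = lc x4\<close> \<open>lc_bar b4 = lc_bar x3\<close> \<open>lc b2 = lc x2\<close> \<open>lc_bar b2 = lc_bar x1\<close>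
  \<comment> \<open>Along \<open>b1\<close>, \<open>b3\<close>, \<open>b4\<close>, \<open>b2\<close>
    the coordinate \<open>lc\<close> increases, while \<open>lc_bar\<close> runs through the
    \<open>x\<close> points in reverse and decreases.\<close>
  have spacelike: "spacelike_separated b1 b3" "spacelike_separated b3 b4" "spacelike_separated b4 b2"
      "spacelike_separated b1 b4" "spacelike_separated b3 b2" "spacelike_separated b1 b2"
    unfolding spacelike_separated_def ip11_diff_lc b
    using o by (auto simp: mult_less_0_iff)
  \<comment> \<open>Each of \<open>m1\<close>, \<open>m2\<close>, \<open>m3\<close>,
    \<open>m4\<close> occurs once above and once below, so the ratio is insensitive to the scale of
    the edges.\<close>
  have "(d x1 x4 * d x2 x3) / (d x1 x2 * d x3 x4)
      = (ip22 p1 p4 * ip22 p2 p3) / (ip22 p1 p2 * ip22 p3 p4)"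
    unfolding e14 e23 e12 e34 using m0 L by simp
  also have "\<dots> = ((L\<^sup>2 + k) / L\<^sup>2)\<^sup>2"
    unfolding k ip using L \<open>k > 0\<close> by (simp add: power2_eq_square)
  finally have ratio: "(d x1 x4 * d x2 x3) / (d x1 x2 * d x3 x4) = ((L\<^sup>2 + k) / L\<^sup>2)\<^sup>2" .
  have "cond_mutual_information (central_charge L G) \<delta> b1 b3 b4 b2 = central_charge L G / 6 * ln
    \<bar>((lc x1 - lc x4) * (lc_bar x2 - lc_bar x3) * ((lc x3 - lc x2) * (lc_bar x4 - lc_bar x1)))
     / ((lc x1 - lc x2) * (lc_bar x2 - lc_bar x1) * ((lc x3 - lc x4) * (lc_bar x4 - lc_bar x3)))\<bar>"
    using o \<open>\<delta> > 0\<close> by (subst cond_mutual_information_cross_ratio) (simp_all add: b)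
  \<comment> \<open>Swapping the barred coordinates mixes the pairs inside each entropy, but
    numerator and denominator regroup separately into the intervals between the \<open>x\<close>
    points.\<close>
  also have "((lc x1 - lc x4) * (lc_bar x2 - lc_bar x3) * ((lc x3 - lc x2) * (lc_bar x4 - lc_bar x1)))
     / ((lc x1 - lc x2) * (lc_bar x2 - lc_bar x1) * ((lc x3 - lc x4) * (lc_bar x4 - lc_bar x3)))
     = (d x1 x4 * d x2 x3) / (d x1 x2 * d x3 x4)"
    by (rule arg_cong2[where f = "(/)"]) (simp_all add: d_def algebra_simps)
  also have "ln \<bar>(d x1 x4 * d x2 x3) / (d x1 x2 * d x3 x4)\<bar> = 2 * ln ((L\<^sup>2 + k) / L\<^sup>2)"
    unfolding ratio using L by (simp add: ln_realpow)
  \<comment> \<open>Both sides have the coefficient \<open>L / (2 * G)\<close> in front of the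
    logarithm.\<close>
  also have "central_charge L G / 6 * (2 * ln ((L\<^sup>2 + k) / L\<^sup>2))
      = lorentzian_area (worldsheet L V1 p1 p4) / (4 * G * L)"
    unfolding lorentzian_area_worldsheet[OF seg k \<open>k > 0\<close> \<open>L > 0\<close>] central_charge_def
    using \<open>L > 0\<close> \<open>G > 0\<close> by (simp add: field_simps power2_eq_square)
  finally show ?thesis using spacelike by blast
qed

end
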